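(* For integers $l,k\ge 2$, as $n\to\infty$, $$ex(n,P_l,C_{2k})\le (1+o(1))\frac12 (k-1)^{\frac{l-1}{2}}n^{\frac{l+1}{2}}.$$
   Context: $C_k$ denotes the cycle with $k$ vertices and $P_l$ the path with $l$ vertices. $ex(n,H,F)$ is the maximum number of subgraphs isomorphic to $H$ in an $n$-vertex graph containing no subgraph isomorphic to $F$. *)

theory Defs
  imports Complex_Main
begin

definition graph_on :: "nat \<Rightarrow> nat set set \<Rightarrow> bool" where
  "graph_on n E \<longleftrightarrow> (\<forall>e\<in>E. e \<subseteq> {..<n} \<and> card e = 2)"

definition path_seq :: "nat set set \<Rightarrow> nat list \<Rightarrow> bool" where
  "path_seq E xs \<longleftrightarrow> distinct xs \<and>
     (\<forall>i. i + 1 < length xs \<longrightarrow> {xs ! i, xs ! (i + 1)} \<in> E)"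

definition path_edges :: "nat list \<Rightarrow> nat set set" where
  "path_edges xs = {{xs ! i, xs ! (i + 1)} | i. i + 1 < length xs}"

text \<open>The subgraphs of E isomorphic to P_l (path on l vertices). For l \<ge> 2 such a
  subgraph is determined by its edge set (its vertex set is the union of its edges).\<close>
definition path_copies :: "nat set set \<Rightarrow> nat \<Rightarrow> nat set set set" where
  "path_copies E l = {path_edges xs | xs. length xs = l \<and> path_seq E xs}"

definition contains_cycle :: "nat set set \<Rightarrow> nat \<Rightarrow> bool" where
  "contains_cycle E m \<longleftrightarrow> (\<exists>xs. length xs = m \<and> path_seq E xs \<and> {last xs, hd xs} \<in> E)"

definition ex_path_cycle :: "nat \<Rightarrow> nat \<Rightarrow> nat \<Rightarrow> nat" where
  "ex_path_cycle n l m =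
     Max ((\<lambda>E. card (path_copies E l)) ` {E. graph_on n E \<and> \<not> contains_cycle E m})"

end

theory Submission
  imports Defs "HOL-Analysis.Convex" "HOL-Real_Asymp.Real_Asymp"
begin

text \<open>
  Let \<open>W j\<close> be the number of walks with \<open>j\<close> edges. Write \<open>N v\<close> for the neighbourhood of \<open>v\<close>.
  In a \<open>C\<^bsub>2k\<^esub>\<close>-free graph no path on \<open>2k - 1\<close> vertices avoiding \<open>v\<close> has both ends in
  \<open>N v\<close>. Deleting vertices of small degree and then building a path greedily shows
  that at most \<open>(k - 1) n + O(deg v)\<close> walks with two edges start at \<open>v\<close>. As the adjacency
  operator is self-adjoint, this gives \<open>W (j + 2) \<le> c W (j + 1) + (k - 1) n W j\<close>, and
  \<open>W 1\<^sup>2 \<le> n W 2\<close> by Cauchy--Schwarz. Hence \<open>W j \<le> n \<lambda>\<^sup>j\<close> for the positive root \<open>\<lambda>\<close> of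
  \<open>\<lambda>\<^sup>2 = c \<lambda> + (k - 1) n\<close>, which is asymptotic to \<open>sqrt ((k - 1) n)\<close>. Finally, every path on
  \<open>l\<close> vertices is traced by two walks with \<open>l - 1\<close> edges.
\<close>

section \<open>Dense relations contain long alternating paths\<close>

text \<open>Repeatedly delete a left vertex with at most \<open>p\<close> partners or a right vertex
  with at most \<open>q\<close>. A deletion costs at most \<open>p\<close> or \<open>q\<close> pairs
  and lowers \<open>p * card A + q * card B\<close> by exactly that number, so the strict inequality
  persists and the process stops before the relation is empty.\<close>

lemma dense_relation_core:
  assumes "finite A" "finite B" "R \<subseteq> A \<times> B" "p * card A + q * card B < card R"
  shows "\<exists>R'\<subseteq>R. R' \<noteq> {} \<and> (\<forall>a b. (a, b) \<in> R' \<longrightarrow> p < card (R' `` {a}) \<and> q < card (R'\<inverse> `` {b}))"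
  using assms
proof (induction "card R" arbitrary: A B R rule: less_induct)
  case less
  have fR: "finite R"
    using less.prems finite_subset by blast
  have "R \<noteq> {}"
    using less.prems by auto
  show ?case
  proof (cases "\<forall>a b. (a, b) \<in> R \<longrightarrow> p < card (R `` {a}) \<and> q < card (R\<inverse> `` {b})")
    case True
    then show ?thesis
      using \<open>R \<noteq> {}\<close> by blast
  next
    case False
    then obtain a b where ab: "(a, b) \<in> R" "card (R `` {a}) \<le> p \<or> card (R\<inverse> `` {b}) \<le> q"
      by fastforce
    then have mem: "a \<in> A" "b \<in> B"
      using less.prems by auto
    from ab(2) show ?thesis
    proof
      assume le: "card (R `` {a}) \<le> p"
      define R' where "R' = R \<inter> (A - {a}) \<times> B"
      have "R \<subseteq> R' \<union> {a} \<times> R `` {a}"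
        using less.prems by (auto simp: R'_def)
      then have "card R \<le> card (R' \<union> {a} \<times> R `` {a})"
        using fR by (intro card_mono) (auto simp: R'_def)
      also have "\<dots> \<le> card R' + card ({a} \<times> R `` {a})"
        by (rule card_Un_le)
      also have "\<dots> \<le> card R' + p"
        using le by (simp add: card_cartesian_product)
      finally have "card R \<le> card R' + p" .
      moreover have "card A = Suc (card (A - {a}))"
        using mem less.prems by (metis card.remove)
      ultimately have "p * card (A - {a}) + q * card B < card R'"
        using less.prems by simp
      moreover have "card R' < card R"
        using fR ab(1) by (intro psubset_card_mono) (auto simp: R'_def)
      ultimately have "\<exists>R''\<subseteq>R'. R'' \<noteq> {} \<and>
          (\<forall>a b. (a, b) \<in> R'' \<longrightarrow> p < card (R'' `` {a}) \<and> q < card (R''\<inverse> `` {b}))"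
        using less.prems by (intro less.hyps[of R' "A - {a}" B]) (auto simp: R'_def)
      then show ?thesis
        by (metis R'_def inf.boundedE)
    next
      assume le: "card (R\<inverse> `` {b}) \<le> q"
      define R' where "R' = R \<inter> A \<times> (B - {b})"
      have "R \<subseteq> R' \<union> R\<inverse> `` {b} \<times> {b}"
        using less.prems by (auto simp: R'_def)
      then have "card R \<le> card (R' \<union> R\<inverse> `` {b} \<times> {b})"
        using fR by (intro card_mono) (auto simp: R'_def)
      also have "\<dots> \<le> card R' + card (R\<inverse> `` {b} \<times> {b})"
        by (rule card_Un_le)
      also have "\<dots> \<le> card R' + q"
        using le by (simp add: card_cartesian_product)
      finally have "card R \<le> card R' + q" .
      moreover have "card B = Suc (card (B - {b}))"
        using mem less.prems by (metis card.remove)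
      ultimately have "p * card A + q * card (B - {b}) < card R'"
        using less.prems by simp
      moreover have "card R' < card R"
        using fR ab(1) by (intro psubset_card_mono) (auto simp: R'_def)
      ultimately have "\<exists>R''\<subseteq>R'. R'' \<noteq> {} \<and>
          (\<forall>a b. (a, b) \<in> R'' \<longrightarrow> p < card (R'' `` {a}) \<and> q < card (R''\<inverse> `` {b}))"
        using less.prems by (intro less.hyps[of R' A "B - {b}"]) (auto simp: R'_def)
      then show ?thesis
        by (metis R'_def inf.boundedE)
    qed
  qed
qed

lemma path_seq_Cons:
  assumes "xs \<noteq> []"
  shows "path_seq E (x # xs) \<longleftrightarrow> x \<notin> set xs \<and> {x, hd xs} \<in> E \<and> path_seq E xs"
proof -
  have "(\<forall>i. i + 1 < length (x # xs) \<longrightarrow> {(x # xs) ! i, (x # xs) ! (i + 1)} \<in> E) \<longleftrightarrow>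
    {x, hd xs} \<in> E \<and> (\<forall>i. i + 1 < length xs \<longrightarrow> {xs ! i, xs ! (i + 1)} \<in> E)"
    (is "(\<forall>i. ?P i) \<longleftrightarrow> _")
  proof -
    have "(\<forall>i. ?P i) \<longleftrightarrow> ?P 0 \<and> (\<forall>i. ?P (Suc i))"
      by (metis not0_implies_Suc)
    then show ?thesis
      using assms by (simp add: hd_conv_nth)
  qed
  then show ?thesis
    unfolding path_seq_def by auto
qed

text \<open>If \<open>A\<close> and \<open>B\<close> are disjoint, the vertices of the path already chosen on the other side
  need not be avoided, whence the smaller degree requirement; otherwise all chosen vertices are
  avoided.\<close>
lemma alternating_path:
  assumes "finite A" "finite B" "R \<subseteq> A \<times> B" and RE: "\<And>a b. (a, b) \<in> R \<Longrightarrow> {a, b} \<in> E"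
    and big: "p * card A + p * card B < card R"
    and p: "A \<inter> B = {} \<and> k \<le> Suc p \<or> 2 * k \<le> p" and "k \<ge> 1"
  shows "\<exists>xs. length xs = 2 * k - 1 \<and> path_seq E xs \<and> set xs \<subseteq> A \<union> B \<and>
    hd xs \<in> A \<and> last xs \<in> A"
proof -
  obtain R' where R': "R' \<subseteq> R" "R' \<noteq> {}"
    and deg: "\<And>a b. (a, b) \<in> R' \<Longrightarrow> p < card (R' `` {a}) \<and> p < card (R'\<inverse> `` {b})"
    using dense_relation_core[OF assms(1-3) big] by auto
  have R'AB: "R' \<subseteq> A \<times> B"
    using R' assms by auto
  \<comment> \<open>Only the members of \<open>S\<close> inside \<open>C\<close> can block a choice
    from \<open>Y\<close>. With \<open>C\<close> one side of the relation, vertices chosen on a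
    disjoint other side cost nothing.\<close>
  have new: "\<exists>y\<in>Y. y \<notin> S" if "card (S \<inter> C) < card Y" "Y \<subseteq> C" "finite S" for Y S C :: "nat set"
  proof (rule ccontr)
    assume "\<not> ?thesis"
    then have "Y \<subseteq> S \<inter> C"
      using that by auto
    then show False
      using that by (meson card_mono finite_Int linorder_not_le)
  qed
  \<comment> \<open>The path grows at its front, two vertices at a time. Keeping the head in
    \<open>Domain R'\<close> guarantees that it has more than \<open>p\<close> partners; the last
    vertex never changes.\<close>
  have "i < k \<Longrightarrow> \<exists>xs. length xs = Suc (2 * i) \<and> path_seq E xs \<and> set xs \<subseteq> A \<union> B \<and>
    hd xs \<in> Domain R' \<and> last xs \<in> A \<and>
    (A \<inter> B = {} \<longrightarrow> card (set xs \<inter> A) \<le> Suc i \<and> card (set xs \<inter> B) \<le> i)" for i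
  proof (induction i)
    case 0
    obtain a b where "(a, b) \<in> R'"
      using R' by auto
    moreover have "a \<in> A"
      using calculation R'AB by auto
    moreover have "A \<inter> B = {} \<Longrightarrow> {a} \<inter> B = {}"
      using calculation by auto
    ultimately show ?case
      by (intro exI[of _ "[a]"]) (auto simp: path_seq_def)
  next
    case (Suc i)
    then obtain xs where xs: "length xs = Suc (2 * i)" "path_seq E xs" "set xs \<subseteq> A \<union> B"
      "hd xs \<in> Domain R'" "last xs \<in> A"
      and count: "A \<inter> B = {} \<Longrightarrow> card (set xs \<inter> A) \<le> Suc i \<and> card (set xs \<inter> B) \<le> i"
      by auto
    have ne: "xs \<noteq> []"
      using xs by auto
    have lenX: "card (set xs \<inter> C) \<le> Suc (2 * i)" for C
      using xs card_length[of xs] card_mono[of "set xs" "set xs \<inter> C"] by auto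
    have "card (set xs \<inter> B) < card (R' `` {hd xs})"
      using xs deg p count lenX[of B] Suc.prems by fastforce
    then obtain b where b: "(hd xs, b) \<in> R'" "b \<notin> set xs"
      using new[of "set xs" B "R' `` {hd xs}"] R'AB by auto
    have bB: "b \<in> B"
      using b R'AB by auto
    \<comment> \<open>The tight spot. If the sides are disjoint, at most \<open>Suc i\<close> \<le>
      \<open>k - 1\<close> \<le> \<open>p\<close> vertices of \<open>A\<close> are taken, which is
      the source of the constant \<open>k - 1\<close>. Otherwise all \<open>2 * i + 2\<close> chosen
      vertices may block, still fewer than \<open>2 * k\<close>.\<close>
    have "card (set (b # xs) \<inter> A) < card (R'\<inverse> `` {b})"
    proof (cases "A \<inter> B = {}")
      case True
      then have "set (b # xs) \<inter> A = set xs \<inter> A"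
        using bB by auto
      then show ?thesis
        using deg[OF b(1)] p count[OF True] Suc.prems by auto
    next
      case False
      have "card (set (b # xs) \<inter> A) \<le> Suc (card (set xs \<inter> A))"
        by (simp add: Int_insert_left card_insert_if)
      then show ?thesis
        using deg[OF b(1)] p False lenX[of A] Suc.prems by auto
    qed
    then obtain a where a: "(a, b) \<in> R'" "a \<notin> set (b # xs)"
      using new[of "set (b # xs)" A "R'\<inverse> `` {b}"] R'AB by auto
    have aA: "a \<in> A"
      using a R'AB by auto
    have "{b, hd xs} \<in> E" "{a, b} \<in> E"
      using RE[of a b] RE[of "hd xs" b] a b R' by (auto simp: insert_commute)
    then have "path_seq E (a # b # xs)"
      using a b xs ne by (simp add: path_seq_Cons)
    moreover have "card (set (a # b # xs) \<inter> A) \<le> Suc (Suc i) \<and> card (set (a # b # xs) \<inter> B) \<le> Suc i"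
      if "A \<inter> B = {}"
    proof -
      have "set (a # b # xs) \<inter> A = insert a (set xs \<inter> A)" "set (a # b # xs) \<inter> B = insert b (set xs \<inter> B)"
        using that aA bB by auto
      then show ?thesis
        using count[OF that] by (simp add: card_insert_if)
    qed
    ultimately show ?case
      using xs ne a(1) aA bB by (intro exI[of _ "a # b # xs"]) auto
  qed
  from this[of "k - 1"] \<open>k \<ge> 1\<close> obtain xs where "length xs = Suc (2 * (k - 1))" "path_seq E xs"
    "set xs \<subseteq> A \<union> B" "hd xs \<in> Domain R'" "last xs \<in> A"
    by auto
  moreover have "Suc (2 * (k - 1)) = 2 * k - 1"
    using \<open>k \<ge> 1\<close> by simp
  ultimately show ?thesis
    using R'AB by auto
qed

section \<open>Walks\<close>

definition nbrs :: "nat set set \<Rightarrow> nat \<Rightarrow> nat set" where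
  "nbrs E v = {u. {v, u} \<in> E}"

text \<open>For a graph with adjacency matrix M, this is the vector M^j 1.\<close>

fun walks_from :: "nat set set \<Rightarrow> nat \<Rightarrow> nat \<Rightarrow> nat" where
  "walks_from E 0 v = 1"
| "walks_from E (Suc j) v = (\<Sum>u\<in>nbrs E v. walks_from E j u)"

definition walks :: "nat \<Rightarrow> nat set set \<Rightarrow> nat \<Rightarrow> nat" where
  "walks n E j = (\<Sum>v<n. walks_from E j v)"

lemma nbrs_sym: "u \<in> nbrs E v \<longleftrightarrow> v \<in> nbrs E u"
  by (simp add: nbrs_def insert_commute)

lemma graph_on_nbrs:
  assumes "graph_on n E"
  shows "nbrs E v \<subseteq> {..<n}" "v \<notin> nbrs E v" "finite (nbrs E v)"
proof -
  show sub: "nbrs E v \<subseteq> {..<n}"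
    using assms by (auto simp: nbrs_def graph_on_def)
  show "v \<notin> nbrs E v"
    using assms by (fastforce simp: nbrs_def graph_on_def)
  show "finite (nbrs E v)"
    using sub finite_subset by blast
qed

text \<open>Both sides sum \<open>g v * f u\<close> over all ordered pairs of adjacent vertices. The
  identity moves a step of a walk from one factor to the other.\<close>

lemma adjacency_self_adjoint:
  fixes f g :: "nat \<Rightarrow> 'a::comm_semiring_0"
  assumes "graph_on n E"
  shows "(\<Sum>v<n. g v * (\<Sum>u\<in>nbrs E v. f u)) = (\<Sum>v<n. (\<Sum>u\<in>nbrs E v. g u) * f v)"
proof -
  have eq: "(\<Sum>u\<in>nbrs E v. h u) = (\<Sum>u<n. if u \<in> nbrs E v then h u else 0)" for h :: "nat \<Rightarrow> 'a" and v
    using graph_on_nbrs[OF assms, of v]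
    by (simp add: sum.If_cases Int_absorb1 flip: Collect_mem_eq)
  have "(\<Sum>v<n. g v * (\<Sum>u\<in>nbrs E v. f u)) = (\<Sum>v<n. \<Sum>u<n. if u \<in> nbrs E v then g v * f u else 0)"
    unfolding eq sum_distrib_left by (intro sum.cong) auto
  also have "\<dots> = (\<Sum>u<n. \<Sum>v<n. if u \<in> nbrs E v then g v * f u else 0)"
    by (rule sum.swap)
  also have "\<dots> = (\<Sum>v<n. (\<Sum>u\<in>nbrs E v. g u) * f v)"
    unfolding eq sum_distrib_right by (intro sum.cong) (auto simp: nbrs_sym)
  finally show ?thesis .
qed

section \<open>Forbidding the cycle bounds the walks with two edges\<close>

lemma cycle_through_vertex:
  assumes "length xs = 2 * k - 1" "path_seq E xs" "k \<ge> 1"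
    "v \<notin> set xs" "hd xs \<in> nbrs E v" "last xs \<in> nbrs E v"
  shows "contains_cycle E (2 * k)"
proof -
  have "xs \<noteq> []"
    using assms by auto
  then have "path_seq E (v # xs)" "{last (v # xs), hd (v # xs)} \<in> E"
    using assms by (auto simp: path_seq_Cons nbrs_def insert_commute)
  then show ?thesis
    using assms unfolding contains_cycle_def by (intro exI[of _ "v # xs"]) auto
qed

text \<open>Walks v, a, w are split by the place of w: at v itself, in the neighbourhood
  \<open>A\<close>, or in the rest \<open>B\<close>. Too many of the second or third kind would give
  an alternating path that closes through v to a forbidden cycle. Only \<open>B\<close> can have
  order n, and there the sides are disjoint, so the sharp \<open>p = k - 1\<close> is available; the
  crude \<open>p = 2 * k\<close> suffices inside \<open>A\<close>.\<close>

lemma two_walks_bound: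
  assumes G: "graph_on n E" and C: "\<not> contains_cycle E (2 * k)" and k: "k \<ge> 1"
  shows "walks_from E 2 v \<le> 5 * k * walks_from E 1 v + (k - 1) * n"
proof -
  define A where "A = nbrs E v"
  define B where "B = {..<n} - A - {v}"
  define R where "R = Sigma A (nbrs E)"
  note nb = graph_on_nbrs[OF G]
  have fA: "finite A" and fB: "finite B" and vA: "v \<notin> A"
    using nb by (auto simp: A_def B_def)
  have bound: "card (R \<inter> A \<times> D) \<le> p * card A + p * card D"
    if D: "finite D" "v \<notin> D" "A \<inter> D = {} \<and> k \<le> Suc p \<or> 2 * k \<le> p" for D p
  proof (rule ccontr)
    assume "\<not> ?thesis"
    then obtain xs where "length xs = 2 * k - 1" "path_seq E xs" "set xs \<subseteq> A \<union> D"
      "hd xs \<in> A" "last xs \<in> A"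
      using alternating_path[of A D "R \<inter> A \<times> D" E p k] fA D k
      by (auto simp: R_def nbrs_def)
    then have "contains_cycle E (2 * k)"
      using D vA k by (intro cycle_through_vertex[of xs k E v]) (auto simp: A_def)
    then show False
      using C by simp
  qed
  have AB: "A \<inter> B = {}" "v \<notin> B"
    by (auto simp: B_def)
  have "walks_from E 2 v = card R"
    using fA nb by (simp add: numeral_2_eq_2 R_def A_def)
  also have "\<dots> \<le> card (A \<times> {v} \<union> (R \<inter> A \<times> A \<union> R \<inter> A \<times> B))"
    using nb fA fB by (intro card_mono) (auto simp: R_def B_def)
  also have "\<dots> \<le> card (A \<times> {v}) + (card (R \<inter> A \<times> A) + card (R \<inter> A \<times> B))"
    by (meson card_Un_le add_left_mono order_trans)
  also have "\<dots> \<le> card A + ((2 * k * card A + 2 * k * card A) + ((k - 1) * card A + (k - 1) * card B))"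
    using bound[of A "2 * k"] bound[of B "k - 1"] fA fB vA AB k
    by (intro add_mono) (auto simp: card_cartesian_product)
  \<comment> \<open>The coefficients of \<open>card A\<close> are 1, 4k and k - 1, with sum
    5k.\<close>
  also have "\<dots> = (4 * k + k) * card A + (k - 1) * card B"
    using k by (cases k) (auto simp: algebra_simps)
  also have "\<dots> \<le> 5 * k * card A + (k - 1) * n"
    using card_mono[of "{..<n}" B] by (auto simp: B_def)
  finally show ?thesis
    by (simp add: A_def)
qed

section \<open>Growth of the walk counts\<close>

lemma walks_recurrence:
  assumes "graph_on n E" "\<not> contains_cycle E (2 * k)" "k \<ge> 1"
  shows "walks n E (Suc (Suc j)) \<le> 5 * k * walks n E (Suc j) + (k - 1) * n * walks n E j"
proof -
  note adj = adjacency_self_adjoint[OF assms(1)]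
  have one: "walks n E (Suc i) = (\<Sum>v<n. walks_from E 1 v * walks_from E i v)" for i
    using adj[of "\<lambda>_. 1" "walks_from E i"] by (simp add: walks_def)
  \<comment> \<open>Cutting a walk after two steps writes the count as the inner product of M^2 1
    and M^j 1, with M the adjacency matrix, so the pointwise bound on M^2 1 applies.\<close>
  have "walks n E (Suc (Suc j)) = (\<Sum>v<n. walks_from E 2 v * walks_from E j v)"
    using adj[of "walks_from E 1" "walks_from E j"] by (simp add: one numeral_2_eq_2)
  also have "\<dots> \<le> (\<Sum>v<n. (5 * k * walks_from E 1 v + (k - 1) * n) * walks_from E j v)"
    using two_walks_bound[OF assms] by (intro sum_mono mult_right_mono) auto
  also have "\<dots> = 5 * k * walks n E (Suc j) + (k - 1) * n * walks n E j"
    unfolding one by (simp add: walks_def sum_distrib_left sum.distrib algebra_simps)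
  finally show ?thesis .
qed

text \<open>\<open>walks n E 2\<close> is the sum of the squared degrees, so this is
  Cauchy--Schwarz. It serves to bound \<open>walks n E 1\<close>, the second initial value of the
  recurrence.\<close>

lemma walks_1_squared:
  assumes "graph_on n E"
  shows "(walks n E 1)\<^sup>2 \<le> n * walks n E 2"
proof -
  have "walks n E 2 = (\<Sum>v<n. (walks_from E 1 v)\<^sup>2)"
    using adjacency_self_adjoint[OF assms, of "\<lambda>_. 1" "walks_from E 1"]
    by (simp add: walks_def numeral_2_eq_2)
  moreover have "(\<Sum>v<n. real (walks_from E 1 v))\<^sup>2 \<le> (\<Sum>v<n. (real (walks_from E 1 v))\<^sup>2) * n"
    using sum_squared_le_sum_of_squares[of "\<lambda>v. real (walks_from E 1 v)" "{..<n}"] by (simp add: mult.commute)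
  ultimately have "real ((walks n E 1)\<^sup>2) \<le> real (n * walks n E 2)"
    by (simp add: walks_def mult.commute)
  then show ?thesis
    by linarith
qed

text \<open>The sequence \<open>n * x ^ j\<close> satisfies the recurrence with equality, as
  \<open>x\<close> is a root of its characteristic equation. Since the coefficients are nonnegative,
  comparing two consecutive initial values suffices.\<close>

lemma walks_le_root_power:
  fixes x :: real
  assumes "graph_on n E" "\<not> contains_cycle E (2 * k)" "k \<ge> 1"
    and x: "x > 0" "x\<^sup>2 = 5 * real k * x + (real k - 1) * real n"
  shows "real (walks n E j) \<le> real n * x ^ j"
proof -
  define c b where "c = 5 * real k" and "b = (real k - 1) * real n"
  have b: "b \<ge> 0" and c: "c \<ge> 0"
    using assms by (auto simp: b_def c_def)
  have x2: "x\<^sup>2 = c * x + b"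
    using x by (simp add: b_def c_def)
  have rec: "real (walks n E (Suc (Suc j))) \<le> c * real (walks n E (Suc j)) + b * real (walks n E j)" for j
    using walks_recurrence[OF assms(1-3), of j, folded of_nat_le_iff[where 'a = real]] assms(3)
    by (simp add: b_def c_def of_nat_diff)
  have W0: "walks n E 0 = n"
    by (simp add: walks_def)
  \<comment> \<open>Cauchy--Schwarz and the recurrence at 0 say that t = W(1)/n satisfies t^2 \<le>
    c t + b, which fails beyond the positive root. The argument is scaled by n^2 because n may be
    0.\<close>
  have W1: "real (walks n E 1) \<le> real n * x"
  proof (rule ccontr)
    define w where "w = real (walks n E 1)"
    assume "\<not> ?thesis"
    then have lt: "real n * x < w"
      by (simp add: w_def)
    have "w\<^sup>2 \<le> real n * real (walks n E 2)"
      using walks_1_squared[OF assms(1), folded of_nat_le_iff[where 'a = real]] by (simp add: w_def)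
    also have "\<dots> \<le> real n * (c * w + b * real n)"
      using rec[of 0] W0 by (intro mult_left_mono) (auto simp: w_def numeral_2_eq_2)
    finally have le: "w\<^sup>2 \<le> real n * c * w + b * (real n)\<^sup>2"
      by (simp add: algebra_simps power2_eq_square)
    have nx: "0 \<le> real n * x"
      using x by simp
    \<comment> \<open>The map t(t - nc) increases strictly beyond nc, and \<open>x\<close> \<ge>
      \<open>c\<close> because x(x - c) = b \<ge> 0.\<close>
    have "w * (w - real n * c) > (real n * x) * (real n * x - real n * c)"
    proof -
      have "(x - c) * x = b"
        using x2 by (simp add: algebra_simps power2_eq_square)
      then have "c \<le> x"
        using x(1) b by (metis diff_ge_0_iff_ge mult_le_0_iff not_le order.strict_iff_not zero_le_mult_iff)
      then have "0 \<le> real n * x - real n * c"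
        by (simp add: mult_left_mono)
      then show ?thesis
        using lt nx by (intro mult_strict_mono') auto
    qed
    moreover have "(real n * x) * (real n * x - real n * c) = (real n)\<^sup>2 * (x\<^sup>2 - c * x)"
      by (simp add: algebra_simps power2_eq_square)
    ultimately have "w * (w - real n * c) > (real n)\<^sup>2 * b"
      using x2 by simp
    then show False
      using le by (simp add: algebra_simps power2_eq_square)
  qed
  have "real (walks n E j) \<le> real n * x ^ j \<and> real (walks n E (Suc j)) \<le> real n * x ^ Suc j"
  proof (induction j)
    case 0
    then show ?case
      using W0 W1 by simp
  next
    case (Suc j)
    have "real (walks n E (Suc (Suc j))) \<le> c * (real n * x ^ Suc j) + b * (real n * x ^ j)"
      using rec[of j] Suc b c by (meson add_mono mult_left_mono order_trans)
    also have "\<dots> = real n * x ^ j * (c * x + b)"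
      by (simp add: algebra_simps)
    also have "\<dots> = real n * x ^ Suc (Suc j)"
      unfolding x2[symmetric] by (simp add: power2_eq_square)
    finally show ?case
      using Suc by simp
  qed
  then show ?thesis ..
qed

section \<open>Paths\<close>

text \<open>Dropping the first vertex of a path leaves a path from a neighbour, which matches the
  recursion of \<open>walks_from\<close>; walks may revisit vertices, hence only an
  inequality.\<close>

lemma card_paths_from_le_walks_from:
  assumes "graph_on n E"
  shows "finite {xs. length xs = Suc j \<and> hd xs = v \<and> path_seq E xs} \<and>
    card {xs. length xs = Suc j \<and> hd xs = v \<and> path_seq E xs} \<le> walks_from E j v"
proof (induction j arbitrary: v)
  case 0
  have "{xs. length xs = Suc 0 \<and> hd xs = v \<and> path_seq E xs} \<subseteq> {[v]}"
    by (auto simp: length_Suc_conv)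
  then show ?case
    using card_mono[of "{[v]}"] finite_subset[of _ "{[v]}"] by simp
next
  case (Suc j)
  let ?P = "\<lambda>j v. {xs. length xs = Suc j \<and> hd xs = v \<and> path_seq E xs}"
  let ?U = "\<Union>u\<in>nbrs E v. Cons v ` ?P j u"
  have fin: "finite (nbrs E v)"
    using graph_on_nbrs[OF assms] by simp
  have sub: "?P (Suc j) v \<subseteq> ?U"
  proof
    fix xs assume xs: "xs \<in> ?P (Suc j) v"
    then obtain ys where "xs = v # ys" "length ys = Suc j"
      by (auto simp: length_Suc_conv)
    moreover have "ys \<noteq> []"
      using calculation by auto
    ultimately show "xs \<in> ?U"
      using xs by (auto simp: path_seq_Cons nbrs_def)
  qed
  have finU: "finite ?U"
    using fin Suc by auto
  have "card ?U \<le> (\<Sum>u\<in>nbrs E v. card (Cons v ` ?P j u))"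
    by (rule card_UN_le[OF fin])
  also have "\<dots> \<le> walks_from E (Suc j) v"
    using Suc by (auto simp: card_image intro!: sum_mono)
  finally show ?case
    using finite_subset[OF sub finU] card_mono[OF finU sub] by linarith
qed

lemma card_paths_le_walks:
  assumes "graph_on n E" "l \<ge> 2"
  shows "finite {xs. length xs = l \<and> path_seq E xs}"
    "card {xs. length xs = l \<and> path_seq E xs} \<le> walks n E (l - 1)"
proof -
  let ?P = "\<lambda>v. {xs. length xs = Suc (l - 1) \<and> hd xs = v \<and> path_seq E xs}"
  have sub: "{xs. length xs = l \<and> path_seq E xs} \<subseteq> (\<Union>v<n. ?P v)"
  proof
    fix xs assume xs: "xs \<in> {xs. length xs = l \<and> path_seq E xs}"
    \<comment> \<open>The first vertex is below \<open>n\<close> because it lies on an edge; a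
      one-vertex list could hold any natural number.\<close>
    then have "{xs ! 0, xs ! 1} \<in> E"
      using assms(2) by (auto simp: path_seq_def)
    moreover have "xs \<noteq> []"
      using xs assms(2) by auto
    ultimately have "hd xs < n"
      using assms(1) by (auto simp: graph_on_def hd_conv_nth)
    then show "xs \<in> (\<Union>v<n. ?P v)"
      using xs assms(2) by auto
  qed
  have fin: "finite (\<Union>v<n. ?P v)"
    using card_paths_from_le_walks_from[OF assms(1)] by blast
  show "finite {xs. length xs = l \<and> path_seq E xs}"
    using sub fin finite_subset by blast
  have "card {xs. length xs = l \<and> path_seq E xs} \<le> card (\<Union>v<n. ?P v)"
    using sub fin card_mono by blast
  also have "\<dots> \<le> (\<Sum>v<n. card (?P v))"
    by (rule card_UN_le) simp
  also have "\<dots> \<le> walks n E (l - 1)"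
    unfolding walks_def using card_paths_from_le_walks_from[OF assms(1)] by (intro sum_mono) blast
  finally show "card {xs. length xs = l \<and> path_seq E xs} \<le> walks n E (l - 1)" .
qed

lemma path_edges_rev_subset: "path_edges (rev xs) \<subseteq> path_edges xs"
proof
  fix e assume "e \<in> path_edges (rev xs)"
  then obtain i where i: "i + 1 < length xs" "e = {rev xs ! i, rev xs ! (i + 1)}"
    by (auto simp: path_edges_def)
  define m where "m = length xs - Suc (Suc i)"
  have "rev xs ! i = xs ! (m + 1)" "rev xs ! (i + 1) = xs ! m" "m + 1 < length xs"
    using i by (auto simp: m_def rev_nth intro!: arg_cong[of _ _ "(!) xs"])
  then show "e \<in> path_edges xs"
    using i by (auto simp: path_edges_def insert_commute)
qed

lemma path_edges_rev: "path_edges (rev xs) = path_edges xs"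
  using path_edges_rev_subset[of xs] path_edges_rev_subset[of "rev xs"] by simp

lemma path_seq_iff_path_edges: "path_seq E xs \<longleftrightarrow> distinct xs \<and> path_edges xs \<subseteq> E"
  by (auto simp: path_seq_def path_edges_def)

lemma rev_neq_self:
  assumes "distinct xs" "length xs \<ge> 2"
  shows "rev xs \<noteq> xs"
proof
  assume "rev xs = xs"
  moreover have "xs \<noteq> []"
    using assms by auto
  ultimately have "xs ! (length xs - 1) = xs ! 0"
    by (metis hd_conv_nth hd_rev last_conv_nth)
  then have "length xs - 1 = 0"
    using assms nth_eq_iff_index_eq[OF assms(1), of "length xs - 1" 0] by linarith
  then show False
    using assms by simp
qed

text \<open>Each fibre of \<open>path_edges\<close> over the path lists contains a list and its
  distinct reversal.\<close>

lemma path_copies_le_walks: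
  assumes "graph_on n E" "l \<ge> 2"
  shows "2 * card (path_copies E l) \<le> walks n E (l - 1)"
proof -
  define P where "P = {xs. length xs = l \<and> path_seq E xs}"
  have fP: "finite P" and cP: "card P \<le> walks n E (l - 1)"
    using card_paths_le_walks[OF assms] by (auto simp: P_def)
  have copies: "path_copies E l = path_edges ` P"
    by (auto simp: path_copies_def P_def)
  have "2 \<le> card {xs \<in> P. path_edges xs = y}" if y: "y \<in> path_edges ` P" for y
  proof -
    obtain xs where xs: "xs \<in> P" "y = path_edges xs"
      using y by auto
    have "rev xs \<noteq> xs"
      using xs assms by (intro rev_neq_self) (auto simp: P_def path_seq_def)
    then have "card {xs, rev xs} = 2"
      by simp
    moreover have "{xs, rev xs} \<subseteq> {xs \<in> P. path_edges xs = y}"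
      using xs by (auto simp: P_def path_seq_iff_path_edges path_edges_rev)
    ultimately show ?thesis
      using card_mono[of "{xs \<in> P. path_edges xs = y}" "{xs, rev xs}"] fP by simp
  qed
  then have "(\<Sum>y\<in>path_edges ` P. 2) \<le> (\<Sum>y\<in>path_edges ` P. card {xs \<in> P. path_edges xs = y})"
    by (rule sum_mono)
  also have "\<dots> = card P"
    using sum.image_gen[OF fP, of "\<lambda>_. 1 :: nat" path_edges] by simp
  finally show ?thesis
    using cP by (simp add: copies mult.commute)
qed

section \<open>The extremal number and its asymptotics\<close>

lemma ex_path_cycle_attained:
  "\<exists>E. graph_on n E \<and> \<not> contains_cycle E m \<and> ex_path_cycle n l m = card (path_copies E l)"
proof -
  let ?S = "{E. graph_on n E \<and> \<not> contains_cycle E m}"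
  \<comment> \<open>\<open>Max\<close> is meaningful only on a finite nonempty set; the empty graph
    is a member, having no closing edge.\<close>
  have "?S \<subseteq> Pow (Pow {..<n})"
    by (auto simp: graph_on_def)
  then have "finite ?S"
    by (rule finite_subset) simp
  moreover have "{} \<in> ?S"
    by (auto simp: graph_on_def contains_cycle_def)
  ultimately have "ex_path_cycle n l m \<in> (\<lambda>E. card (path_copies E l)) ` ?S"
    unfolding ex_path_cycle_def by (intro Max_in) auto
  then show ?thesis
    by auto
qed

theorem theorem17:
  fixes l k :: nat
  assumes "l \<ge> 2" and "k \<ge> 2"
  shows "\<exists>f :: nat \<Rightarrow> real. (f \<longlonglongrightarrow> 0) \<and>
    (\<forall>\<^sub>F n in sequentially.
       real (ex_path_cycle n l (2 * k)) \<le>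
         (1 + f n) * (1 / 2) * (real k - 1) powr ((real l - 1) / 2) * real n powr ((real l + 1) / 2))"
proof -
  define c K where "c = 5 * real k" and "K = real k - 1"
  have cK: "c > 0" "K > 0"
    using assms by (auto simp: c_def K_def)
  \<comment> \<open>The positive root of t^2 = c t + K n.\<close>
  define x where "x = (\<lambda>n. (c + sqrt (c\<^sup>2 + 4 * K * real n)) / 2)"
  \<comment> \<open>Chosen so that \<open>x n ^ (l - 1)\<close> is exactly \<open>1 + f n\<close>
    times \<open>sqrt (K * real n) ^ (l - 1)\<close> once \<open>n\<close> is positive.\<close>
  define f where "f = (\<lambda>n. (x n / sqrt (K * real n)) ^ (l - 1) - 1)"
  \<comment> \<open>As \<open>K\<close> is positive, the term 4Kn dominates under the root and
    \<open>c\<close> is negligible.\<close>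
  have "(\<lambda>n. x n / sqrt (K * real n)) \<longlonglongrightarrow> 1"
    unfolding x_def using cK by real_asymp (simp add: powr_half_sqrt real_sqrt_mult)
  then have "f \<longlonglongrightarrow> 1 ^ (l - 1) - 1"
    unfolding f_def by (intro tendsto_intros)
  then have "f \<longlonglongrightarrow> 0"
    by simp
  moreover have "real (ex_path_cycle n l (2 * k)) \<le>
      (1 + f n) * (1 / 2) * (real k - 1) powr ((real l - 1) / 2) * real n powr ((real l + 1) / 2)"
    if n: "n \<ge> 1" for n
  proof -
    obtain E where E: "graph_on n E" "\<not> contains_cycle E (2 * k)"
      "ex_path_cycle n l (2 * k) = card (path_copies E l)"
      using ex_path_cycle_attained by blast
    have x0: "x n > 0"
      using cK by (auto simp: x_def intro!: add_pos_nonneg)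
    have "(sqrt (c\<^sup>2 + 4 * K * real n))\<^sup>2 = c\<^sup>2 + 4 * K * real n"
      using cK by simp
    then have "(x n)\<^sup>2 = c * x n + K * real n"
      unfolding x_def by (simp add: power2_eq_square field_simps)
    then have "real (walks n E (l - 1)) \<le> real n * x n ^ (l - 1)"
      using x0 assms E by (intro walks_le_root_power[of n E k]) (auto simp: c_def K_def)
    then have "real (ex_path_cycle n l (2 * k)) \<le> 1 / 2 * (real n * x n ^ (l - 1))"
      using path_copies_le_walks[OF E(1) assms(1)] E(3) by linarith
    also have "x n ^ (l - 1) = (1 + f n) * sqrt (K * real n) ^ (l - 1)"
      using cK n by (simp add: f_def power_divide)
    also have "sqrt (K * real n) ^ (l - 1) = (K * real n) powr ((real l - 1) / 2)"
      using cK n assms by (simp add: powr_half_sqrt[symmetric] powr_powr of_nat_diff flip: powr_realpow)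
    also have "\<dots> = K powr ((real l - 1) / 2) * real n powr ((real l - 1) / 2)"
      using cK by (simp add: powr_mult)
    finally have "real (ex_path_cycle n l (2 * k)) \<le>
      (1 + f n) * (1 / 2) * K powr ((real l - 1) / 2) * (real n powr 1 * real n powr ((real l - 1) / 2))"
      using n by (simp add: algebra_simps)
    also have "real n powr 1 * real n powr ((real l - 1) / 2) = real n powr ((real l + 1) / 2)"
      unfolding powr_add[symmetric] by (simp add: field_simps)
    finally show ?thesis
      by (simp add: K_def)
  qed
  ultimately show ?thesis
    by (meson eventually_sequentiallyI)
qed

end
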